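(* Assume $\mathfrak{b}=\mathfrak{c}$. There exists an order embedding of the real line into the set of P-points ordered by the Rudin–Keisler ordering, i.e. a map $\xi\mapsto D_\xi$ from $\mathbb{R}$ to P-points such that $D_\xi<_{RK}D_\eta$ whenever $\xi<\eta$.
   Context: $\mathfrak{b}$ is the bounding number and $\mathfrak{c}=2^{\aleph_0}$. A free ultrafilter $u$ on a countable set $X$ is a P-point if for every partition $(V_n)_{n<\omega}$ of $X$ there is $U\in u$ with either $U\subseteq V_n$ for some $n$ or $U\cap V_n$ finite for all $n$. For ultrafilters $u,v$ on countable sets $X,Y$, $u\ge_{RK}v$ if there is a map $h:X\to Y$ with $h^{-1}(V)\in u$ for all $V\in v$; $u>_{RK}v$ means $u\ge_{RK}v$ and not $v\ge_{RK}u$. *)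

theory Defs
  imports Complex_Main "HOL-Library.Disjoint_Sets" "HOL-Library.Countable"
begin

unbundle cardinal_syntax

section \<open>The bounding number\<close>

definition eventually_le :: "(nat \<Rightarrow> nat) \<Rightarrow> (nat \<Rightarrow> nat) \<Rightarrow> bool" where
  "eventually_le f g \<longleftrightarrow> (\<forall>\<^sub>F n in sequentially. f n \<le> g n)"

definition unbounded_family :: "(nat \<Rightarrow> nat) set \<Rightarrow> bool" where
  "unbounded_family F \<longleftrightarrow> \<not> (\<exists>g. \<forall>f\<in>F. eventually_le f g)"

text \<open>
  The least cardinality of an unbounded family, represented by the cardinal order of some
  unbounded family of least cardinality. Any two choices give order-isomorphic cardinals, so
  the definition is meaningful up to \<open>=o\<close>; see \<open>bounding_number_characterization\<close>.
\<close>
definition bounding_number :: "(nat \<Rightarrow> nat) rel" where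
  "bounding_number =
     |SOME F. unbounded_family F \<and> (\<forall>G. unbounded_family G \<longrightarrow> |F| \<le>o |G| )|"

lemma unbounded_family_UNIV: "unbounded_family UNIV"
proof -
  have "\<not> eventually_le (\<lambda>n. Suc (g n)) g" for g
    by (simp add: eventually_le_def)
  then show ?thesis
    unfolding unbounded_family_def by blast
qed

lemma bounding_number_characterization:
  "\<exists>F. unbounded_family F \<and> bounding_number = |F| \<and>
       (\<forall>G. unbounded_family G \<longrightarrow> bounding_number \<le>o |G| )"
proof -
  let ?R = "card_of ` Collect unbounded_family"
  have "?R \<noteq> {}"
    using unbounded_family_UNIV by blast
  moreover have "\<forall>r\<in>?R. Card_order r"
    by (auto simp: card_of_Card_order)
  ultimately have "\<exists>r\<in>?R. \<forall>r'\<in>?R. r \<le>o r'"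
    by (rule exists_minim_Card_order)
  then have "\<exists>F. unbounded_family F \<and> (\<forall>G. unbounded_family G \<longrightarrow> |F| \<le>o |G| )"
    by auto
  from someI_ex[OF this] show ?thesis
    unfolding bounding_number_def by blast
qed


section \<open>P-points and the Rudin--Keisler ordering\<close>

text \<open>
  An ultrafilter on a set is represented by a filter on a type, the members of the ultrafilter
  being the sets \<open>A\<close> such that \<open>\<forall>\<^sub>F x in u. x \<in> A\<close>.
\<close>
definition ultrafilter :: "'a filter \<Rightarrow> bool" where
  "ultrafilter u \<longleftrightarrow> u \<noteq> bot \<and> (\<forall>A. (\<forall>\<^sub>F x in u. x \<in> A) \<or> (\<forall>\<^sub>F x in u. x \<in> - A))"

definition free_ultrafilter :: "'a filter \<Rightarrow> bool" where
  "free_ultrafilter u \<longleftrightarrow> ultrafilter u \<and> (\<forall>A. (\<forall>\<^sub>F x in u. x \<in> A) \<longrightarrow> infinite A)"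

text \<open>The pieces of a partition indexed by the naturals are allowed to be empty.\<close>
definition p_point :: "'a::countable filter \<Rightarrow> bool" where
  "p_point u \<longleftrightarrow> free_ultrafilter u \<and>
     (\<forall>V :: nat \<Rightarrow> 'a set. disjoint_family V \<and> (\<Union>n. V n) = UNIV \<longrightarrow>
        (\<exists>U. (\<forall>\<^sub>F x in u. x \<in> U) \<and> ((\<exists>n. U \<subseteq> V n) \<or> (\<forall>n. finite (U \<inter> V n)))))"

definition rk_ge :: "'a::countable filter \<Rightarrow> 'b::countable filter \<Rightarrow> bool" where
  "rk_ge u v \<longleftrightarrow> (\<exists>h :: 'a \<Rightarrow> 'b. \<forall>V. (\<forall>\<^sub>F y in v. y \<in> V) \<longrightarrow> (\<forall>\<^sub>F x in u. x \<in> h -` V))"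

definition rk_greater :: "'a::countable filter \<Rightarrow> 'b::countable filter \<Rightarrow> bool" where
  "rk_greater u v \<longleftrightarrow> rk_ge u v \<and> \<not> rk_ge v u"

end

(*
  Let X be the countable set of words in letters (r, k) with r rational and k natural, and let
  h_xi keep the letters whose rational is below xi. Every D_xi is the image under h_xi of one
  P-point E on X. Then D_xi <= D_eta for xi < eta, and D_eta <= D_xi would give a map g with
  g (h_xi x) = h_eta x for E-almost all x, because a map sending an ultrafilter to itself is the
  identity almost everywhere. So it suffices that E contains no set on which, for some rational
  t, the letters below t determine the letters at t. The finite unions of subsets of such sets
  form a proper ideal which is F_sigma, by compactness of finite colourings.

  Under b = c every proper F_sigma ideal containing the finite sets is avoided by a P-point:
  enumerate the maps V : X -> nat in type c and choose a set for each, keeping all finite intersections outside the ideal. If no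
  fibre of V can be added, each finite intersection F is positive beyond every n, with a finite
  witness bounded by f_F(n); as there are fewer than b functions f_F, some g dominates them all,
  and {x. x <= g(V x)}, made monotone, meets every F positively and every fibre of V finitely.
*)
theory Submission
  imports Defs "HOL-Library.Diagonal_Subsequence" "HOL-Library.Infinite_Set"
begin

section \<open>P-points avoiding an $F_\sigma$ ideal\<close>

lemma card_of_finite_ordLess_infinite:
  assumes "finite A" "infinite B"
  shows "|A| <o |B|"
  using ordLess_or_ordLeq[OF card_of_Well_order card_of_Well_order, of A B]
proof
  assume "|B| \<le>o |A|"
  then show ?thesis
    using assms card_of_ordLeq_finite by blast
qed

text \<open>Adding one element maps pairs of an element and an \<open>n\<close>-subset onto the
  subsets of size \<open>n + 1\<close>, so each of the countably many sizes contributes at most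
  \<open>|A|\<close> sets.\<close>

lemma card_of_Fpow_ordLeq:
  assumes "infinite A"
  shows "|Fpow A| \<le>o |A|"
proof -
  have nat: "|UNIV :: nat set| \<le>o |A|"
    using assms by (simp add: infinite_iff_card_of_nat)
  let ?P = "\<lambda>n. {X. X \<subseteq> A \<and> finite X \<and> card X = n}"
  have level: "|?P n| \<le>o |A|" for n
  proof (induction n)
    case 0
    have "finite (?P 0)"
      by (rule finite_subset[of _ "{{}}"]) auto
    then show ?case
      using assms card_of_finite_ordLess_infinite ordLess_imp_ordLeq by blast
  next
    case (Suc n)
    have "?P (Suc n) \<subseteq> (\<lambda>(a, X). insert a X) ` (A \<times> ?P n)"
    proof
      fix X assume X: "X \<in> ?P (Suc n)"
      then obtain a Y where "X = insert a Y" "a \<notin> Y" "card Y = n"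
        by (auto simp: card_Suc_eq)
      with X show "X \<in> (\<lambda>(a, X). insert a X) ` (A \<times> ?P n)"
        by (auto intro!: image_eqI[of _ _ "(a, Y)"])
    qed
    then have "|?P (Suc n)| \<le>o |A \<times> ?P n|"
      by (rule surj_imp_ordLeq)
    also have "|A \<times> ?P n| \<le>o |A|"
    proof (rule card_of_Times_ordLeq_infinite_Field)
      show "infinite (Field |A| )"
        using assms by (simp add: Field_card_of)
      show "|A| \<le>o |A|"
        by (rule ordIso_imp_ordLeq[OF card_of_refl])
      show "Card_order |A|"
        by (rule card_of_Card_order)
    qed (rule Suc)
    finally show ?case .
  qed
  have "Fpow A = (\<Union>n. ?P n)"
    by (auto simp: Fpow_def)
  moreover have "|\<Union>n. ?P n| \<le>o |A|"
    using assms nat level by (intro card_of_UNION_ordLeq_infinite) auto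
  ultimately show ?thesis by simp
qed

lemma card_of_nat_valued_ordLeq_continuum:
  "|UNIV :: ('a::countable \<Rightarrow> nat) set| \<le>o ctwo ^c natLeq"
proof -
  let ?F = "Func (UNIV :: nat set) (UNIV :: bool set)"
  define graph :: "('a \<Rightarrow> nat) \<Rightarrow> nat \<Rightarrow> bool"
    where "graph V k \<longleftrightarrow> (\<exists>x. k = prod_encode (to_nat x, V x))" for V k
  have "inj graph"
  proof (rule injI, rule ext)
    fix V W and x :: 'a
    assume "graph V = graph W"
    then have "graph W (prod_encode (to_nat x, V x))"
      unfolding graph_def by metis
    then show "V x = W x"
      by (auto simp: graph_def)
  qed
  moreover have "range graph \<subseteq> ?F"
    by (auto simp: Func_def)
  ultimately have "|UNIV :: ('a \<Rightarrow> nat) set| \<le>o |?F|"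
    using card_of_ordLeq by blast
  then show ?thesis
    by (simp add: cexp_def ctwo_def Field_natLeq Field_card_of)
qed

lemma eventually_bounded_if_small:
  assumes "|F| <o bounding_number"
  shows "\<exists>g. \<forall>f\<in>F. eventually_le f g"
proof -
  have "\<not> unbounded_family F"
    using bounding_number_characterization not_ordLess_ordLeq[OF assms] by metis
  then show ?thesis
    by (simp add: unbounded_family_def)
qed

text \<open>
  The ideal is \<open>\<Union>n. K n\<close>; by \<open>K_compact\<close> each \<open>K n\<close> is closed in the product topology on
  the power set.
\<close>
locale fsigma_ideal =
  fixes K :: "nat \<Rightarrow> 'a::countable set \<Rightarrow> bool"
  assumes K_mono: "K m A \<Longrightarrow> m \<le> n \<Longrightarrow> K n A"
    and K_subset: "K n B \<Longrightarrow> A \<subseteq> B \<Longrightarrow> K n A"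
    and K_compact: "(\<And>B. finite B \<Longrightarrow> B \<subseteq> A \<Longrightarrow> K n B) \<Longrightarrow> K n A"
    and K_finite: "finite A \<Longrightarrow> \<exists>n. K n A"
    and K_Un: "K m A \<Longrightarrow> K n B \<Longrightarrow> \<exists>k. K k (A \<union> B)"
    and K_proper: "\<not> K n UNIV"
begin

definition small :: "'a set \<Rightarrow> bool" where
  "small A \<longleftrightarrow> (\<exists>n. K n A)"

definition centered :: "'a set set \<Rightarrow> bool" where
  "centered \<A> \<longleftrightarrow> (\<forall>Z\<in>Fpow \<A>. \<not> small (\<Inter>Z))"

text \<open>The alternative demanded of a P-point, for the partition into the fibres of
  \<open>V\<close>. Two-valued \<open>V\<close> will also yield the ultrafilter property.\<close>

definition tames :: "('a \<Rightarrow> nat) \<Rightarrow> 'a set \<Rightarrow> bool" where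
  "tames V U \<longleftrightarrow> (\<exists>n. U \<subseteq> V -` {n}) \<or> (\<forall>n. finite (U \<inter> V -` {n}))"

lemma small_subset: "small B \<Longrightarrow> A \<subseteq> B \<Longrightarrow> small A"
  unfolding small_def using K_subset by blast

lemma small_Un: "small A \<Longrightarrow> small B \<Longrightarrow> small (A \<union> B)"
  unfolding small_def using K_Un by blast

lemma small_finite: "finite A \<Longrightarrow> small A"
  unfolding small_def using K_finite by blast

lemma small_UN_atMost: "(\<And>i::nat. i \<le> n \<Longrightarrow> small (A i)) \<Longrightarrow> small (\<Union>i\<le>n. A i)"
  by (induction n) (auto simp: atMost_Suc intro!: small_Un)

lemma finite_witness:
  assumes "\<not> small A"
  shows "\<exists>N. \<not> K n (A \<inter> {x. to_nat x \<le> N})"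
proof -
  obtain B where B: "finite B" "B \<subseteq> A" "\<not> K n B"
    using assms K_compact[of A n] unfolding small_def by blast
  obtain N where "\<forall>k\<in>to_nat ` B. k \<le> N"
    using B(1) finite_nat_set_iff_bounded_le by blast
  then have "B \<subseteq> A \<inter> {x. to_nat x \<le> N}"
    using B(2) by auto
  then show ?thesis
    using B(3) K_subset by blast
qed

text \<open>One stage of the construction. The second hypothesis is the only form in which the
  bounding number enters here.\<close>

lemma centered_extend:
  assumes cent: "centered \<A>"
    and bounded: "\<And>f :: 'a set set \<Rightarrow> nat \<Rightarrow> nat. \<exists>g. \<forall>Z\<in>Fpow \<A>. eventually_le (f Z) g"
  shows "\<exists>U. tames V U \<and> centered (insert U \<A>)"
proof -
  have suff: "centered (insert U \<A>)" if "\<And>Z. Z \<in> Fpow \<A> \<Longrightarrow> \<not> small (U \<inter> \<Inter>Z)" for U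
    unfolding centered_def
  proof
    fix Z assume Z: "Z \<in> Fpow (insert U \<A>)"
    then have "Z - {U} \<in> Fpow \<A>"
      by (auto simp: Fpow_def)
    moreover have "U \<inter> \<Inter>(Z - {U}) \<subseteq> \<Inter>Z" by blast
    ultimately show "\<not> small (\<Inter>Z)"
      using that small_subset by blast
  qed
  show ?thesis
  proof (cases "\<exists>n. \<forall>Z\<in>Fpow \<A>. \<not> small (V -` {n} \<inter> \<Inter>Z)")
    case True
    then show ?thesis
      unfolding tames_def using suff by blast
  next
    case False
    then obtain Y where Y: "\<And>n. Y n \<in> Fpow \<A>" "\<And>n. small (V -` {n} \<inter> \<Inter>(Y n))"
      by metis
    \<comment> \<open>Adjoining \<open>Y 0\<close>, ..., \<open>Y n\<close> to \<open>Z\<close>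
      makes the part where \<open>V\<close> is at most \<open>n\<close> small, so the rest has to be
      positive.\<close>
    have beyond: "\<not> small (\<Inter>Z \<inter> {x. n < V x})" if Z: "Z \<in> Fpow \<A>" for Z n
    proof
      assume s: "small (\<Inter>Z \<inter> {x. n < V x})"
      let ?W = "Z \<union> (\<Union>i\<le>n. Y i)"
      have "?W \<in> Fpow \<A>"
        using Z Y(1) by (auto simp: Fpow_def)
      then have "\<not> small (\<Inter>?W)"
        using cent by (simp add: centered_def)
      moreover have "\<Inter>?W \<subseteq> (\<Inter>Z \<inter> {x. n < V x}) \<union> (\<Union>i\<le>n. V -` {i} \<inter> \<Inter>(Y i))"
        by (force simp: not_less)
      ultimately show False
        using s small_Un small_UN_atMost Y(2) small_subset by meson
    qed
    then have "\<exists>N. \<not> K n (\<Inter>Z \<inter> {x. n < V x} \<inter> {x. to_nat x \<le> N})" if "Z \<in> Fpow \<A>" for Z n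
      using finite_witness that by blast
    then obtain f where f: "\<And>Z n. Z \<in> Fpow \<A> \<Longrightarrow>
        \<not> K n (\<Inter>Z \<inter> {x. n < V x} \<inter> {x. to_nat x \<le> f Z n})"
      by metis
    obtain g where g: "\<And>Z. Z \<in> Fpow \<A> \<Longrightarrow> eventually_le (f Z) g"
      using bounded by blast
    \<comment> \<open>For almost all \<open>n\<close>, \<open>U\<close> contains the finite witness that \<open>\<Inter>Z\<close> is not in \<open>K n\<close>.\<close>
    define U where "U = {x. \<exists>i\<le>V x. to_nat x \<le> g i}"
    have "finite (U \<inter> V -` {n})" for n
    proof (rule finite_subset)
      show "U \<inter> V -` {n} \<subseteq> to_nat -` (\<Union>i\<le>n. {..g i})"
        by (auto simp: U_def)
      show "finite (to_nat -` (\<Union>i\<le>n. {..g i}) :: 'a set)"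
        by (intro finite_vimageI) auto
    qed
    moreover have "\<not> small (U \<inter> \<Inter>Z)" if Z: "Z \<in> Fpow \<A>" for Z
    proof
      assume "small (U \<inter> \<Inter>Z)"
      then obtain k where k: "K k (U \<inter> \<Inter>Z)"
        by (auto simp: small_def)
      have "\<forall>\<^sub>F n in sequentially. k \<le> n \<and> f Z n \<le> g n"
        using g[OF Z] by (auto simp: eventually_le_def intro: eventually_conj eventually_ge_at_top)
      then obtain n where n: "k \<le> n" "f Z n \<le> g n"
        using eventually_happens' trivial_limit_sequentially by blast
      have "\<Inter>Z \<inter> {x. n < V x} \<inter> {x. to_nat x \<le> f Z n} \<subseteq> U \<inter> \<Inter>Z"
      proof
        fix x assume x: "x \<in> \<Inter>Z \<inter> {x. n < V x} \<inter> {x. to_nat x \<le> f Z n}"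
        then have "n \<le> V x" "to_nat x \<le> g n"
          using n(2) by auto
        with x show "x \<in> U \<inter> \<Inter>Z"
          unfolding U_def by blast
      qed
      then show False
        using f[OF Z] K_mono[OF k n(1)] K_subset by blast
    qed
    ultimately show ?thesis
      unfolding tames_def using suff by blast
  qed
qed

text \<open>Transfinite recursion along a cardinal well-order of all maps \<open>V\<close>: every
  proper initial segment has fewer than continuum many, hence fewer than bounding number many,
  elements.\<close>

lemma centered_taming_family:
  assumes "bounding_number =o ctwo ^c natLeq"
  shows "\<exists>U. (\<forall>V. tames V (U V)) \<and> centered (range U)"
proof -
  let ?r = "|UNIV :: ('a \<Rightarrow> nat) set|"
  let ?R = "?r - Id"
  have co: "Card_order ?r" by (rule card_of_Card_order)
  then have wo: "Well_order ?r"
    by (rule card_order_on_well_order_on)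
  then have wf: "wf ?R"
    by (simp add: well_order_on_def)
  have Field: "Field ?r = UNIV" by (rule Field_card_of)
  have total: "(x, y) \<in> ?r \<or> (y, x) \<in> ?r" for x y
    using wo Field unfolding well_order_on_def linear_order_on_def total_on_def
      partial_order_on_def preorder_on_def refl_on_def by (metis UNIV_I)
  have trans: "trans ?r"
    using wo by (simp add: well_order_on_def linear_order_on_def
      partial_order_on_def preorder_on_def)
  have infT: "infinite (UNIV :: ('a \<Rightarrow> nat) set)"
  proof
    assume "finite (UNIV :: ('a \<Rightarrow> nat) set)"
    moreover have "inj (\<lambda>n (x :: 'a). n :: nat)"
      by (rule injI) (simp add: fun_eq_iff)
    ultimately show False
      using finite_subset[OF subset_UNIV] finite_imageD infinite_UNIV_nat by metis
  qed
  have r_le: "?r \<le>o bounding_number"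
    using card_of_nat_valued_ordLeq_continuum assms ordIso_symmetric ordLeq_ordIso_trans by blast
  define P where "P \<equiv> \<lambda>U V S. tames V S \<and> centered (insert S (U ` underS ?r V))"
  have max: "\<exists>m\<in>B. B \<subseteq> insert m (underS ?r m)" if "finite B" "B \<noteq> {}" for B
    using that
  proof (induction rule: finite_ne_induct)
    case (insert x B)
    then obtain m where m: "m \<in> B" "B \<subseteq> insert m (underS ?r m)"
      by blast
    show ?case
    proof (cases "(x, m) \<in> ?r")
      case True
      then show ?thesis
        using m by (auto simp: underS_def)
    next
      case False
      then have "(m, x) \<in> ?r"
        using total by blast
      then have "(y, x) \<in> ?r" if "y \<in> insert x B" "y \<noteq> x" for y
        using that m(2) transD[OF trans, of y m x] by (auto simp: underS_def)
      then show ?thesis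
        by (auto simp: underS_def)
    qed
  qed auto
  \<comment> \<open>Finitely many choices are all covered by \<open>P\<close> at their latest stage,
    so limit stages need no separate argument. The empty intersection is \<open>UNIV\<close>, which
    is handled by \<open>K_proper\<close>.\<close>
  have chain: "centered (U ` A)" if P: "\<And>m. m \<in> A \<Longrightarrow> P U m (U m)" for U A
    unfolding centered_def
  proof
    fix Z assume "Z \<in> Fpow (U ` A)"
    then obtain B where B: "B \<subseteq> A" "finite B" "Z = U ` B"
      unfolding Fpow_def using finite_subset_image[of Z U A] by blast
    show "\<not> small (\<Inter>Z)"
    proof (cases "B = {}")
      case True
      then show ?thesis
        using B K_proper by (simp add: small_def)
    next
      case False
      then obtain m where m: "m \<in> B" "B \<subseteq> insert m (underS ?r m)"
        using max B(2) by blast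
      then have "Z \<in> Fpow (insert (U m) (U ` underS ?r m))"
        using B by (auto simp: Fpow_def)
      then show ?thesis
        using P[of m] m(1) B(1) unfolding P_def centered_def by blast
    qed
  qed
  have "\<exists>U. \<forall>V. P U V (U V)"
  proof (rule dependent_wf_choice[OF wf])
    fix f g V S
    assume "\<And>W. (W, V) \<in> ?R \<Longrightarrow> f W = (g W :: 'a set)"
    then have "f ` underS ?r V = g ` underS ?r V"
      by (intro image_cong) (auto simp: underS_def)
    then show "P f V S = P g V S"
      by (simp add: P_def)
  next
    fix V f
    assume IH: "\<And>W. (W, V) \<in> ?R \<Longrightarrow> P f W (f W)"
    let ?A = "underS ?r V"
    have "centered (f ` ?A)"
      using IH by (intro chain) (auto simp: underS_def)
    moreover have "\<exists>g. \<forall>Z\<in>Fpow (f ` ?A). eventually_le (h Z) g" for h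
    proof -
      have "|?A| <o ?r"
        using co Field by (intro card_of_underS) auto
      have "|f ` ?A| <o ?r"
        using \<open>|?A| <o ?r\<close> card_of_image ordLeq_ordLess_trans by blast
      then have "|Fpow (f ` ?A)| <o ?r"
      proof (cases "finite (f ` ?A)")
        case True
        then show ?thesis
          using infT by (intro card_of_finite_ordLess_infinite) (auto simp: Fpow_def)
      next
        case False
        then show ?thesis
          using \<open>|f ` ?A| <o ?r\<close> card_of_Fpow_ordLeq ordLeq_ordLess_trans by blast
      qed
      then have "|h ` Fpow (f ` ?A)| <o bounding_number"
        using card_of_image ordLeq_ordLess_trans ordLess_ordLeq_trans r_le by metis
      then show ?thesis
        using eventually_bounded_if_small by blast
    qed
    ultimately show "\<exists>S. P f V S"
      unfolding P_def using centered_extend by blast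
  qed
  then obtain U where U: "\<And>V. P U V (U V)"
    by blast
  then have "centered (range U)"
    by (intro chain)
  with U show ?thesis
    unfolding P_def by blast
qed

text \<open>The P-point is the filter generated by the taming family; each member contains a finite
  intersection of the family and so is not small.\<close>

lemma p_point_avoiding:
  assumes "bounding_number =o ctwo ^c natLeq"
  shows "\<exists>D. p_point D \<and> (\<forall>n A. K n A \<longrightarrow> \<not> (\<forall>\<^sub>F x in D. x \<in> A))"
proof -
  obtain U where tames: "\<And>V. tames V (U V)" and cent: "centered (range U)"
    using centered_taming_family[OF assms] by blast
  define D where "D = (INF V. principal (U V))"
  have U_mem: "\<forall>\<^sub>F x in D. x \<in> U V" for V
    unfolding D_def by (rule eventually_INF1[of V]) (auto simp: eventually_principal)
  have avoid: "\<not> small A" if A: "\<forall>\<^sub>F x in D. x \<in> A" for A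
  proof
    assume "small A"
    obtain Z where Z: "finite Z" "\<forall>\<^sub>F x in INF V\<in>Z. principal (U V). x \<in> A"
      using A[unfolded D_def, THEN eventually_INF[THEN iffD1]] by blast
    then have "\<Inter>(U ` Z) \<subseteq> A"
      by (auto simp: INF_principal_finite eventually_principal)
    then have "small (\<Inter>(U ` Z))"
      using \<open>small A\<close> small_subset by blast
    moreover have "U ` Z \<in> Fpow (range U)"
      using Z(1) by (auto simp: Fpow_def)
    ultimately show False
      using cent unfolding centered_def by blast
  qed
  have nontrivial: "D \<noteq> bot"
    using avoid[of "{}"] small_finite by auto
  have ultra: "(\<forall>\<^sub>F x in D. x \<in> A) \<or> (\<forall>\<^sub>F x in D. x \<in> - A)" for A
  proof -
    define V where "V x = (if x \<in> A then 0 else 1 :: nat)" for x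
    have "U V = (U V \<inter> V -` {0}) \<union> (U V \<inter> V -` {1})"
      by (auto simp: V_def split: if_splits)
    \<comment> \<open>An infinite set cannot meet both fibres of a two-valued map finitely, so
      \<open>U V\<close> lies inside one fibre.\<close>
    moreover have "infinite (U V)"
      using U_mem[of V] avoid[of "U V"] small_finite[of "U V"] by blast
    ultimately have "\<not> (\<forall>n. finite (U V \<inter> V -` {n}))"
      by (metis finite_UnI)
    then obtain n where n: "U V \<subseteq> V -` {n}"
      using tames[of V] unfolding tames_def by blast
    show ?thesis
    proof (cases "n = 0")
      case True
      then have "x \<in> A" if "x \<in> U V" for x
        using n that by (auto simp: V_def split: if_splits)
      then have "\<forall>\<^sub>F x in D. x \<in> A"
        by (rule eventually_mono[OF U_mem[of V]])
      then show ?thesis ..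
    next
      case False
      then have "x \<in> - A" if "x \<in> U V" for x
        using n that by (auto simp: V_def split: if_splits)
      then have "\<forall>\<^sub>F x in D. x \<in> - A"
        by (rule eventually_mono[OF U_mem[of V]])
      then show ?thesis ..
    qed
  qed
  have "p_point D"
    unfolding p_point_def free_ultrafilter_def ultrafilter_def
  proof (intro conjI allI impI)
    fix A assume "\<forall>\<^sub>F x in D. x \<in> A"
    then show "infinite A"
      using avoid small_finite by blast
  next
    fix W :: "nat \<Rightarrow> 'a set"
    assume W: "disjoint_family W \<and> (\<Union>n. W n) = UNIV"
    then have "\<forall>x. \<exists>n. x \<in> W n" by blast
    then obtain V where V: "\<And>x. x \<in> W (V x)" by metis
    have "V -` {n} = W n" for n
      using W V unfolding disjoint_family_on_def by blast
    with tames[of V] U_mem[of V]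
    show "\<exists>U. (\<forall>\<^sub>F x in D. x \<in> U) \<and> ((\<exists>n. U \<subseteq> W n) \<or> (\<forall>n. finite (U \<inter> W n)))"
      unfolding tames_def by auto
  qed (use nontrivial ultra in auto)
  with avoid show ?thesis
    unfolding small_def by blast
qed

end

section \<open>Images of P-points and maps fixing an ultrafilter\<close>

lemma ultrafilter_not_bot: "ultrafilter u \<Longrightarrow> u \<noteq> bot"
  by (simp add: ultrafilter_def)

lemma ultrafilter_cases:
  assumes "ultrafilter u"
  shows "(\<forall>\<^sub>F x in u. P x) \<or> (\<forall>\<^sub>F x in u. \<not> P x)"
  using assms[unfolded ultrafilter_def, THEN conjunct2, THEN spec, of "{x. P x}"] by simp

lemma ultrafilter_disj:
  assumes "ultrafilter u" "\<forall>\<^sub>F x in u. P x \<or> Q x"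
  shows "(\<forall>\<^sub>F x in u. P x) \<or> (\<forall>\<^sub>F x in u. Q x)"
  using ultrafilter_cases[OF assms(1), of P]
proof
  assume "\<forall>\<^sub>F x in u. \<not> P x"
  with assms(2) have "\<forall>\<^sub>F x in u. Q x"
    by eventually_elim auto
  then show ?thesis ..
qed auto

lemma ultrafilter_mem_finite:
  assumes "ultrafilter u" "finite A" "\<forall>\<^sub>F x in u. f x \<in> A"
  shows "\<exists>a\<in>A. \<forall>\<^sub>F x in u. f x = a"
  using assms(2,3)
proof (induction A)
  case empty
  then show ?case
    using ultrafilter_not_bot[OF assms(1)] by simp
next
  case (insert a A)
  then show ?case
    using ultrafilter_disj[OF assms(1), of "\<lambda>x. f x = a" "\<lambda>x. f x \<in> A"] by auto
qed

text \<open>Partitions are pulled back along \<open>f\<close> and the resulting set is pushed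
  forward. A finite set in the image would make \<open>f\<close> constant on a member of
  \<open>u\<close>, so \<open>nonconst\<close> gives freeness.\<close>

lemma p_point_filtermap:
  fixes u :: "'a::countable filter" and f :: "'a \<Rightarrow> 'b::countable"
  assumes u: "p_point u" and nonconst: "\<And>y. \<not> (\<forall>\<^sub>F x in u. f x = y)"
  shows "p_point (filtermap f u)"
proof -
  have ultra: "ultrafilter u"
    using u by (simp add: p_point_def free_ultrafilter_def)
  show ?thesis
    unfolding p_point_def free_ultrafilter_def
  proof (intro conjI allI impI)
    show "ultrafilter (filtermap f u)"
      unfolding ultrafilter_def eventually_filtermap filtermap_bot_iff
      using ultrafilter_not_bot[OF ultra] ultrafilter_cases[OF ultra, of "\<lambda>x. f x \<in> _"] by auto
  next
    fix A assume A: "\<forall>\<^sub>F y in filtermap f u. y \<in> A"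
    show "infinite A"
      using ultrafilter_mem_finite[OF ultra _ A[unfolded eventually_filtermap]] nonconst by blast
  next
    fix V :: "nat \<Rightarrow> 'b set"
    assume V: "disjoint_family V \<and> (\<Union>n. V n) = UNIV"
    let ?W = "\<lambda>n. f -` V n"
    have "disjoint_family ?W \<and> (\<Union>n. ?W n) = UNIV"
      using V unfolding disjoint_family_on_def by blast
    then obtain U where U: "\<forall>\<^sub>F x in u. x \<in> U"
      "(\<exists>n. U \<subseteq> ?W n) \<or> (\<forall>n. finite (U \<inter> ?W n))"
      using u unfolding p_point_def by blast
    have "\<forall>\<^sub>F y in filtermap f u. y \<in> f ` U"
      unfolding eventually_filtermap using U(1) by (rule eventually_mono) blast
    moreover have "(\<exists>n. f ` U \<subseteq> V n) \<or> (\<forall>n. finite (f ` U \<inter> V n))"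
      using U(2)
    proof
      assume "\<forall>n. finite (U \<inter> ?W n)"
      moreover have "f ` U \<inter> V n = f ` (U \<inter> ?W n)" for n by blast
      ultimately show ?thesis by simp
    qed blast
    ultimately show "\<exists>U. (\<forall>\<^sub>F y in filtermap f u. y \<in> U) \<and>
        ((\<exists>n. U \<subseteq> V n) \<or> (\<forall>n. finite (U \<inter> V n)))"
      by blast
  qed
qed

section \<open>Maps sending an ultrafilter on the naturals to itself\<close>

lemma parity_colouring_decreasing:
  fixes f :: "nat \<Rightarrow> nat"
  shows "\<exists>p :: nat \<Rightarrow> bool. \<forall>x. f x < x \<longrightarrow> p (f x) \<noteq> p x"
  \<comment> \<open>When the colour of \<open>x\<close> is chosen, that of the smaller number
    \<open>f x\<close> is already fixed.\<close>
  by (rule dependent_wf_choice[OF wf_less_than, of "\<lambda>p x r. f x < x \<longrightarrow> p (f x) \<noteq> r"]) auto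

lemma parity_colouring_increasing:
  fixes f :: "nat \<Rightarrow> nat"
  assumes inc: "\<And>x. x < f x"
  shows "\<exists>p :: nat \<Rightarrow> bool. \<forall>x. p (f x) \<noteq> p x"
proof -
  \<comment> \<open>The orbits of \<open>x\<close> and \<open>r\<close> meet after \<open>m\<close>
    and \<open>n\<close> steps respectively.\<close>
  let ?R = "\<lambda>x r m n. (f ^^ m) x = (f ^^ n) r"
  have mono: "strict_mono (\<lambda>k. (f ^^ k) r)" for r
    unfolding strict_mono_Suc_iff using inc by simp
  \<comment> \<open>Two-colour each connected component of the graph of \<open>f\<close> by distance from a representative.\<close>
  define rep where "rep x = (LEAST r. \<exists>m n. ?R x r m n)" for x
  have rep: "\<exists>m n. ?R x (rep x) m n" for x
    unfolding rep_def by (rule LeastI[of _ x]) blast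
  have rep_f: "rep (f x) = rep x" for x
  proof -
    have "(\<exists>m n. ?R (f x) r m n) \<longleftrightarrow> (\<exists>m n. ?R x r m n)" for r
    proof
      assume "\<exists>m n. ?R (f x) r m n"
      then show "\<exists>m n. ?R x r m n"
        by (metis funpow_swap1 funpow.simps(2) o_apply)
    next
      assume "\<exists>m n. ?R x r m n"
      then obtain m n where "?R x r m n" by blast
      then have "?R (f x) r m (Suc n)"
        by (simp add: funpow_swap1[symmetric])
      then show "\<exists>m n. ?R (f x) r m n" by blast
    qed
    then show ?thesis by (simp add: rep_def)
  qed
  \<comment> \<open>Iterates of \<open>r\<close> are distinct, so two meetings have the same
    difference of step counts.\<close>
  have parity: "even (m + n) \<longleftrightarrow> even (m' + n')" if "?R x r m n" "?R x r m' n'" for x r m n m' n'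
  proof -
    have "(f ^^ (m' + n)) r = (f ^^ (m + n')) r"
      using that by (metis add.commute funpow_add o_apply)
    then have "m' + n = m + n'"
      using strict_mono_eq[OF mono] by blast
    then show ?thesis by presburger
  qed
  define p where "p x \<longleftrightarrow> (\<exists>m n. ?R x (rep x) m n \<and> even (m + n))" for x
  have p: "p x \<longleftrightarrow> even (m + n)" if "?R x (rep x) m n" for x m n
    unfolding p_def using that parity by blast
  have "p (f x) \<noteq> p x" for x
  proof -
    obtain m n where mn: "?R x (rep x) m n"
      using rep by blast
    then have "?R (f x) (rep (f x)) m (Suc n)"
      by (simp add: rep_f funpow_swap1[symmetric])
    from p[OF this] p[OF mn] show ?thesis by simp
  qed
  then show ?thesis by blast
qed

text \<open>A two-colouring is constant on a member of \<open>u\<close>, and \<open>p\<close>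
  composed with \<open>f\<close> takes the same constant almost everywhere. Colourings that change
  along \<open>f\<close> thus exclude both \<open>f x < x\<close> and
  \<open>x < f x\<close>.\<close>

lemma ultrafilter_fixed_map:
  fixes u :: "nat filter"
  assumes u: "ultrafilter u" and fixed: "\<And>V. \<forall>\<^sub>F x in u. x \<in> V \<Longrightarrow> \<forall>\<^sub>F x in u. f x \<in> V"
  shows "\<forall>\<^sub>F x in u. f x = x"
proof -
  have not_coloured: False if "\<forall>\<^sub>F x in u. p (f x) \<noteq> p x" for p :: "nat \<Rightarrow> bool"
  proof -
    have "(\<forall>\<^sub>F x in u. p x = True) \<or> (\<forall>\<^sub>F x in u. p x = False)"
      using ultrafilter_cases[OF u, of p] by simp
    then obtain b where b: "\<forall>\<^sub>F x in u. p x = b"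
      by blast
    then have "\<forall>\<^sub>F x in u. p (f x) = b"
      using fixed[of "{x. p x = b}"] by simp
    with b that have "\<forall>\<^sub>F x in u. False"
      by eventually_elim auto
    then show False
      using ultrafilter_not_bot[OF u] by simp
  qed
  have "\<not> (\<forall>\<^sub>F x in u. f x < x)"
  proof
    obtain p :: "nat \<Rightarrow> bool" where p: "\<And>x. f x < x \<Longrightarrow> p (f x) \<noteq> p x"
      using parity_colouring_decreasing by blast
    assume "\<forall>\<^sub>F x in u. f x < x"
    then show False
      using p by (intro not_coloured[of p]) (auto elim: eventually_mono)
  qed
  moreover have "\<not> (\<forall>\<^sub>F x in u. x < f x)"
  proof
    \<comment> \<open>Off the set where \<open>f\<close> increases, the successor is a default that
      makes the map increasing everywhere.\<close>
    define f' where "f' x = (if x < f x then f x else Suc x)" for x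
    have "x < f' x" for x
      by (simp add: f'_def)
    then obtain p :: "nat \<Rightarrow> bool" where p: "\<And>x. p (f' x) \<noteq> p x"
      using parity_colouring_increasing by blast
    assume "\<forall>\<^sub>F x in u. x < f x"
    then have "\<forall>\<^sub>F x in u. p (f x) \<noteq> p x"
      by (rule eventually_mono) (use p in \<open>metis f'_def\<close>)
    then show False by (rule not_coloured)
  qed
  ultimately have "\<forall>\<^sub>F x in u. \<not> f x < x" "\<forall>\<^sub>F x in u. \<not> x < f x"
    using ultrafilter_cases[OF u] by blast+
  then show ?thesis
    by eventually_elim simp
qed

section \<open>The ideal of predictable sets\<close>

text \<open>A colour doubles as the index of its relation, so \<open>n\<close> bounds both the
  number of pieces and the relations allowed. This leaves finitely many options per point, as
  compactness requires.\<close>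

definition colourable :: "(nat \<Rightarrow> 'a \<Rightarrow> 'a \<Rightarrow> bool) \<Rightarrow> nat \<Rightarrow> 'a set \<Rightarrow> bool" where
  "colourable R n A \<longleftrightarrow>
     (\<exists>c. (\<forall>x\<in>A. c x < n) \<and> (\<forall>x\<in>A. \<forall>y\<in>A. c x = c y \<longrightarrow> R (c x) x y))"

lemma colourable_mono: "colourable R m A \<Longrightarrow> m \<le> n \<Longrightarrow> colourable R n A"
  unfolding colourable_def by (meson less_le_trans)

lemma colourable_subset: "colourable R n B \<Longrightarrow> A \<subseteq> B \<Longrightarrow> colourable R n A"
  unfolding colourable_def by (meson subsetD)

text \<open>Colourings of the finite sets \<open>B k\<close> converge pointwise along a diagonal
  subsequence; the condition concerns two points at a time and survives in the limit.\<close>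

lemma colourable_compact:
  fixes A :: "'a::countable set"
  assumes fin: "\<And>B. finite B \<Longrightarrow> B \<subseteq> A \<Longrightarrow> colourable R n B"
  shows "colourable R n A"
proof -
  define B where "B k = A \<inter> {x. to_nat x \<le> k}" for k
  have "colourable R n (B k)" for k
  proof (rule fin)
    have "finite (to_nat -` {..k} :: 'a set)"
      by (intro finite_vimageI) auto
    then show "finite (B k)"
      by (rule rev_finite_subset) (auto simp: B_def)
  qed (simp add: B_def)
  then have "\<forall>k. \<exists>c. (\<forall>x\<in>B k. c x < n) \<and> (\<forall>x\<in>B k. \<forall>y\<in>B k. c x = c y \<longrightarrow> R (c x) x y)"
    unfolding colourable_def by blast
  from choice[OF this] obtain c where c: "\<And>k x. x \<in> B k \<Longrightarrow> c k x < n"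
    "\<And>k x y. x \<in> B k \<Longrightarrow> y \<in> B k \<Longrightarrow> c k x = c k y \<Longrightarrow> R (c k x) x y"
    by blast
  \<comment> \<open>The default 0 bounds \<open>b\<close> by \<open>n\<close> everywhere, also when
    \<open>n\<close> is 0.\<close>
  define b where "b k x = (if x \<in> B k then c k x else 0)" for k x
  define P where "P m s \<longleftrightarrow> (\<exists>v. \<forall>j. b (s j) (from_nat m) = v)" for m and s :: "nat \<Rightarrow> nat"
  interpret subseqs P
  proof
    fix m and s :: "nat \<Rightarrow> nat"
    define v where "v j = b (s j) (from_nat m)" for j
    have "range v \<subseteq> {..n}"
      using c(1) by (auto simp: v_def b_def less_imp_le)
    then have "finite (range v)"
      by (rule finite_subset) simp
    then obtain j0 where "infinite {j \<in> UNIV. v j = v j0}"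
      using pigeonhole_infinite[of UNIV v] by auto
    then obtain r :: "nat \<Rightarrow> nat" where r: "strict_mono r" "\<forall>j. r j \<in> {j \<in> UNIV. v j = v j0}"
      using infinite_enumerate by blast
    then have "P m (s \<circ> r)"
      unfolding P_def by (intro exI[of _ "v j0"]) (simp add: v_def)
    with r(1) show "\<exists>r. strict_mono r \<and> P m (s \<circ> r)"
      by blast
  qed
  have "P m (diagseq \<circ> ((+) (Suc m)))" for m
    by (rule diagseq_holds) (auto simp: P_def)
  then obtain d where d: "\<And>m j. b (diagseq (Suc m + j)) (from_nat m) = d m"
    unfolding P_def o_def by metis
  \<comment> \<open>Past the code of \<open>x\<close> the diagonal colourings are all defined at
    \<open>x\<close> and have reached their limit there.\<close>
  have agree: "x \<in> B (diagseq N) \<and> c (diagseq N) x = d (to_nat x)"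
    if "x \<in> A" "to_nat x < N" for x N
  proof -
    have "N \<le> diagseq N"
      by (rule seq_suble[OF subseq_diagseq])
    then have "x \<in> B (diagseq N)"
      using that by (simp add: B_def)
    moreover have "N = Suc (to_nat x) + (N - Suc (to_nat x))"
      using that(2) by simp
    then have "b (diagseq N) x = d (to_nat x)"
      using d[of "to_nat x" "N - Suc (to_nat x)"] by simp
    ultimately show ?thesis
      by (simp add: b_def)
  qed
  show ?thesis
    unfolding colourable_def
  proof (intro exI[of _ "\<lambda>x. d (to_nat x)"] conjI ballI impI)
    fix x assume "x \<in> A"
    from agree[OF this lessI] show "d (to_nat x) < n"
      using c(1) by metis
  next
    fix x y assume xy: "x \<in> A" "y \<in> A" "d (to_nat x) = d (to_nat y)"
    let ?N = "Suc (to_nat x + to_nat y)"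
    have "x \<in> B (diagseq ?N) \<and> c (diagseq ?N) x = d (to_nat x)"
      "y \<in> B (diagseq ?N) \<and> c (diagseq ?N) y = d (to_nat y)"
      using agree[OF xy(1), of ?N] agree[OF xy(2), of ?N] by simp_all
    then show "R (d (to_nat x)) x y"
      using c(2)[of x "diagseq ?N" y] xy(3) by simp
  qed
qed

text \<open>The maps \<open>e True\<close> and \<open>e False\<close> rename the two sets of colours
  apart without changing the relation attached to any colour.\<close>

lemma colourable_Un:
  assumes A: "colourable R m A" and B: "colourable R n B"
    and e: "\<And>j i. R (e j i) = R i" "inj (\<lambda>(j :: bool, i). e j i)"
  shows "\<exists>k. colourable R k (A \<union> B)"
proof -
  obtain a where a: "\<And>x. x \<in> A \<Longrightarrow> a x < m"
    "\<And>x y. x \<in> A \<Longrightarrow> y \<in> A \<Longrightarrow> a x = a y \<Longrightarrow> R (a x) x y"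
    using A unfolding colourable_def by blast
  obtain b where b: "\<And>x. x \<in> B \<Longrightarrow> b x < n"
    "\<And>x y. x \<in> B \<Longrightarrow> y \<in> B \<Longrightarrow> b x = b y \<Longrightarrow> R (b x) x y"
    using B unfolding colourable_def by blast
  have e_eq: "e j i = e j' i' \<longleftrightarrow> j = j' \<and> i = i'" for j j' i i'
    using injD[OF e(2), of "(j, i)" "(j', i')"] by auto
  define c where "c x = (if x \<in> A then e True (a x) else e False (b x))" for x
  have "c ` (A \<union> B) \<subseteq> e True ` {..<m} \<union> e False ` {..<n}"
    using a(1) b(1) by (auto simp: c_def)
  then have "finite (c ` (A \<union> B))"
    by (rule finite_subset) simp
  then obtain k where k: "\<forall>i\<in>c ` (A \<union> B). i < k"
    using finite_nat_set_iff_bounded by blast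
  have "R (c x) x y" if "x \<in> A \<union> B" "y \<in> A \<union> B" "c x = c y" for x y
    using that a(2)[of x y] b(2)[of x y] by (auto simp: c_def e_eq e(1) split: if_splits)
  with k have "colourable R k (A \<union> B)"
    unfolding colourable_def by (intro exI[of _ c]) auto
  then show ?thesis ..
qed

lemma colourable_finite:
  fixes A :: "'a::countable set"
  assumes "finite A" and refl: "\<And>i x. R i x x"
  shows "\<exists>n. colourable R n A"
proof -
  obtain n where "\<forall>i\<in>to_nat ` A. i < n"
    using assms(1) finite_nat_set_iff_bounded by blast
  then have "colourable R n A"
    unfolding colourable_def using refl by (intro exI[of _ to_nat]) auto
  then show ?thesis ..
qed

section \<open>Words and the predictability of their letters\<close>

text \<open>Every rational is the level of infinitely many colours.\<close>
definition level :: "nat \<Rightarrow> rat" where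
  "level i = fst (from_nat i :: rat \<times> nat)"

abbreviation below :: "rat \<Rightarrow> (rat \<times> nat) list \<Rightarrow> (rat \<times> nat) list" where
  "below t \<equiv> filter (\<lambda>p. fst p < t)"

abbreviation fibre :: "rat \<Rightarrow> (rat \<times> nat) list \<Rightarrow> (rat \<times> nat) list" where
  "fibre t \<equiv> filter (\<lambda>p. fst p = t)"

definition predicts :: "nat \<Rightarrow> (rat \<times> nat) list \<Rightarrow> (rat \<times> nat) list \<Rightarrow> bool" where
  "predicts i x y \<longleftrightarrow>
     (below (level i) x = below (level i) y \<longrightarrow> fibre (level i) x = fibre (level i) y)"

lemma level_to_nat: "level (to_nat (t, j :: nat)) = t"
  by (simp add: level_def)

text \<open>
  The word is extended by one letter for each level, in increasing order; only finitely many
  choices of that letter are predicted by the shorter word.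
\<close>
lemma unpredicted_word:
  assumes c: "\<forall>x y. c x = c y \<longrightarrow> predicts (c x) x y"
    and "finite T"
  shows "\<exists>w. fst ` set w \<subseteq> T \<and>
    (\<forall>i<n. level i \<in> T \<longrightarrow>
      (\<forall>y. c y = i \<longrightarrow> below (level i) y = below (level i) w \<longrightarrow> fibre (level i) y \<noteq> fibre (level i) w))"
  using \<open>finite T\<close>
proof (induction T rule: finite_linorder_max_induct)
  case empty
  show ?case by (rule exI[of _ "[]"]) simp
next
  case (insert t T)
  then obtain w where w: "fst ` set w \<subseteq> T"
    "\<forall>i<n. level i \<in> T \<longrightarrow>
      (\<forall>y. c y = i \<longrightarrow> below (level i) y = below (level i) w \<longrightarrow> fibre (level i) y \<noteq> fibre (level i) w)"
    by (elim exE conjE)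
  \<comment> \<open>The letters at \<open>t\<close> that would let colour \<open>i\<close> predict
    the extension of \<open>w\<close>. Words of one colour of level \<open>t\<close> that agree
    below \<open>t\<close> agree at \<open>t\<close>, so there is at most one such
    \<open>k\<close>.\<close>
  define bad where "bad i = {k. \<exists>y. c y = i \<and> below t y = w \<and> fibre t y = [(t, k)]}" for i
  have "finite (bad i)" if "level i = t" for i
  proof -
    have "k = k'" if k: "k \<in> bad i" "k' \<in> bad i" for k k'
    proof -
      obtain y y' where "c y = i" "below t y = w" "fibre t y = [(t, k)]"
        "c y' = i" "below t y' = w" "fibre t y' = [(t, k')]"
        using k unfolding bad_def by blast
      then show ?thesis
        using c[rule_format, of y y'] \<open>level i = t\<close> by (simp add: predicts_def)
    qed
    then have "bad i = {} \<or> (\<exists>k. bad i = {k})"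
      by blast
    then show ?thesis
      by auto
  qed
  then have "finite (\<Union>i\<in>{i. i < n \<and> level i = t}. bad i)"
    by auto
  then obtain k where k: "\<And>i. i < n \<Longrightarrow> level i = t \<Longrightarrow> k \<notin> bad i"
    using ex_new_if_finite[OF infinite_UNIV_nat] by blast
  let ?w = "w @ [(t, k)]"
  have below_t: "below t ?w = w"
    using w(1) insert.hyps(2) by (auto simp: filter_id_conv)
  have fibre_t: "fibre t ?w = [(t, k)]"
    using w(1) insert.hyps(2) by (auto simp: filter_empty_conv)
  \<comment> \<open>Earlier levels lie strictly below \<open>t\<close>, so the new letter is
    invisible to them.\<close>
  have old: "below s ?w = below s w" "fibre s ?w = fibre s w" if "s \<in> T" for s
    using insert.hyps(2) that by auto
  show ?case
  proof (intro exI[of _ ?w] conjI allI impI)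
    show "fst ` set ?w \<subseteq> insert t T"
      using w(1) by auto
  next
    fix i y
    assume i: "i < n" "level i \<in> insert t T" "c y = i" "below (level i) y = below (level i) ?w"
    show "fibre (level i) y \<noteq> fibre (level i) ?w"
    proof (cases "level i = t")
      case True
      then show ?thesis
        using k[OF i(1) True] i(3,4) below_t fibre_t by (auto simp: bad_def)
    next
      case False
      then have "level i \<in> T"
        using i(2) by simp
      then show ?thesis
        using w(2) i old by simp
    qed
  qed
qed

text \<open>With \<open>T\<close> the levels of all colours below \<open>n\<close>, the word
  \<open>w\<close> escapes every colour class, including the one that contains \<open>w\<close>
  itself.\<close>

lemma not_colourable_UNIV: "\<not> colourable predicts n UNIV"
proof
  assume "colourable predicts n UNIV"
  then obtain c where c: "\<And>x. c x < n" "\<forall>x y. c x = c y \<longrightarrow> predicts (c x) x y"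
    unfolding colourable_def by blast
  from unpredicted_word[OF c(2) finite_imageI[OF finite_lessThan], of level n n] obtain w where
    "\<forall>i<n. level i \<in> level ` {..<n} \<longrightarrow>
      (\<forall>y. c y = i \<longrightarrow> below (level i) y = below (level i) w \<longrightarrow> fibre (level i) y \<noteq> fibre (level i) w)"
    by (elim exE conjE) simp
  then show False
    using c(1)[of w] by auto
qed

interpretation unpredictability: fsigma_ideal "colourable predicts"
proof
  fix m n :: nat and A B :: "(rat \<times> nat) list set"
  show "\<exists>n. colourable predicts n A" if "finite A"
    using that by (rule colourable_finite) (simp add: predicts_def)
  show "\<exists>k. colourable predicts k (A \<union> B)"
    if "colourable predicts m A" "colourable predicts n B"
  proof (rule colourable_Un[OF that])
    \<comment> \<open>The level is kept, and the second component encodes which copy of which colour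
      is meant.\<close>
    let ?e = "\<lambda>(j :: bool) i. to_nat (level i, to_nat (j, i))"
    show "predicts (?e j i) = predicts i" for j i
      by (simp add: predicts_def level_to_nat fun_eq_iff)
    show "inj (\<lambda>(j, i). ?e j i)"
      by (auto intro!: injI)
  qed
qed (fact colourable_mono colourable_subset colourable_compact not_colourable_UNIV)+

text \<open>For a rational \<open>t\<close> between \<xi> and \<eta>, \<open>h \<xi>\<close> factors
  through \<open>below t\<close> and \<open>fibre t\<close> factors through \<open>h \<eta>\<close>,
  so a single colour of level \<open>t\<close> suffices for \<open>A\<close>.\<close>

lemma colourable_if_determined:
  fixes A :: "(rat \<times> nat) list set" and \<xi> \<eta> :: real
  defines "h \<equiv> \<lambda>\<zeta>. filter (\<lambda>p. of_rat (fst p) < \<zeta>)"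
  assumes "\<xi> < \<eta>" and determined: "\<And>x y. x \<in> A \<Longrightarrow> y \<in> A \<Longrightarrow> h \<xi> x = h \<xi> y \<Longrightarrow> h \<eta> x = h \<eta> y"
  shows "\<exists>n. colourable predicts n A"
proof -
  obtain t where t: "\<xi> < of_rat t" "of_rat t < \<eta>"
    using of_rat_dense[OF \<open>\<xi> < \<eta>\<close>] by blast
  have h_below: "h \<xi> (below t x) = h \<xi> x" for x
  proof -
    have "of_rat (fst p) < \<xi> \<Longrightarrow> fst p < t" for p :: "rat \<times> nat"
      using t(1) by (metis less_trans of_rat_less)
    then show ?thesis
      unfolding h_def filter_filter by (intro filter_cong) auto
  qed
  have fibre_h: "fibre t (h \<eta> x) = fibre t x" for x
    unfolding h_def filter_filter using t(2) by (intro filter_cong) auto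
  have "predicts (to_nat (t, 0 :: nat)) x y" if xy: "x \<in> A" "y \<in> A" for x y
    unfolding predicts_def level_to_nat
  proof
    assume "below t x = below t y"
    then have "h \<xi> x = h \<xi> y"
      using h_below[of x] h_below[of y] by simp
    then have "h \<eta> x = h \<eta> y"
      using determined xy by blast
    then show "fibre t x = fibre t y"
      using fibre_h[of x] fibre_h[of y] by simp
  qed
  then have "colourable predicts (Suc (to_nat (t, 0 :: nat))) A"
    unfolding colourable_def by (intro exI[of _ "\<lambda>_. to_nat (t, 0 :: nat)"]) blast
  then show ?thesis ..
qed

section \<open>The increasing chain of images\<close>

theorem theorem6:
  assumes "bounding_number =o ctwo ^c natLeq"
  shows "\<exists>D :: real \<Rightarrow> nat filter.
           (\<forall>\<xi>. p_point (D \<xi>)) \<and> (\<forall>\<xi> \<eta>. \<xi> < \<eta> \<longrightarrow> rk_greater (D \<eta>) (D \<xi>))"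
proof -
  obtain E :: "(rat \<times> nat) list filter" where E: "p_point E"
    and avoid: "\<And>n A. colourable predicts n A \<Longrightarrow> \<not> (\<forall>\<^sub>F x in E. x \<in> A)"
    using unpredictability.p_point_avoiding[OF assms] by blast
  define h :: "real \<Rightarrow> (rat \<times> nat) list \<Rightarrow> (rat \<times> nat) list"
    where "h \<zeta> = filter (\<lambda>p. of_rat (fst p) < \<zeta>)" for \<zeta>
  define D where "D \<zeta> = filtermap (\<lambda>x. to_nat (h \<zeta> x)) E" for \<zeta>
  have h_h: "h \<xi> (h \<eta> x) = h \<xi> x" if "\<xi> < \<eta>" for \<xi> \<eta> x
    unfolding h_def filter_filter using that by (intro filter_cong) auto
  have undetermined: "\<not> (\<forall>\<^sub>F x in E. g (to_nat (h \<xi> x)) = to_nat (h \<eta> x))"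
    if "\<xi> < \<eta>" for \<xi> \<eta> g
  proof -
    let ?A = "{x. g (to_nat (h \<xi> x)) = to_nat (h \<eta> x)}"
    have "h \<eta> x = h \<eta> y" if xy: "x \<in> ?A" "y \<in> ?A" "h \<xi> x = h \<xi> y" for x y
    proof -
      have "to_nat (h \<eta> x) = g (to_nat (h \<xi> x))"
        using xy(1) by simp
      also have "\<dots> = g (to_nat (h \<xi> y))"
        by (simp only: xy(3))
      also have "\<dots> = to_nat (h \<eta> y)"
        using xy(2) by simp
      finally show ?thesis by simp
    qed
    then obtain n where "colourable predicts n ?A"
      using colourable_if_determined[OF \<open>\<xi> < \<eta>\<close>, of ?A] unfolding h_def by blast
    from avoid[OF this] show ?thesis by simp
  qed
  have p_point_D: "p_point (D \<eta>)" for \<eta>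
    unfolding D_def
  proof (rule p_point_filtermap[OF E])
    fix y
    \<comment> \<open>A constant value would be determined by the letters below
      \<open>\<eta> - 1\<close>.\<close>
    show "\<not> (\<forall>\<^sub>F x in E. to_nat (h \<eta> x) = y)"
      using undetermined[of "\<eta> - 1" \<eta> "\<lambda>_. y"] by (simp add: eq_commute)
  qed
  have "rk_greater (D \<eta>) (D \<xi>)" if "\<xi> < \<eta>" for \<xi> \<eta>
    unfolding rk_greater_def
  proof
    \<comment> \<open>On codes, \<open>k\<close> deletes the letters from \<xi> upwards and so
      carries \<open>D \<eta>\<close> to \<open>D \<xi>\<close>.\<close>
    define k :: "nat \<Rightarrow> nat" where "k z = to_nat (h \<xi> (from_nat z))" for z
    have k: "k (to_nat (h \<eta> x)) = to_nat (h \<xi> x)" for x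
      by (simp add: k_def h_h[OF that])
    have k_D: "\<forall>\<^sub>F z in D \<eta>. k z \<in> V" if "\<forall>\<^sub>F y in D \<xi>. y \<in> V" for V
      using that by (simp add: D_def eventually_filtermap k)
    then show "rk_ge (D \<eta>) (D \<xi>)"
      unfolding rk_ge_def by (intro exI[of _ k]) simp
    show "\<not> rk_ge (D \<xi>) (D \<eta>)"
    proof
      assume "rk_ge (D \<xi>) (D \<eta>)"
      then obtain g where g: "\<And>V. \<forall>\<^sub>F y in D \<eta>. y \<in> V \<Longrightarrow> \<forall>\<^sub>F x in D \<xi>. g x \<in> V"
        unfolding rk_ge_def by auto
      \<comment> \<open>The composite of \<open>g\<close> after \<open>k\<close> sends
        \<open>D \<eta>\<close> to itself.\<close>
      have "\<forall>\<^sub>F z in D \<eta>. g (k z) = z"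
      proof (rule ultrafilter_fixed_map)
        show "ultrafilter (D \<eta>)"
          using p_point_D by (simp add: p_point_def free_ultrafilter_def)
        show "\<forall>\<^sub>F z in D \<eta>. g (k z) \<in> V" if "\<forall>\<^sub>F z in D \<eta>. z \<in> V" for V
          using k_D[of "g -` V"] g[OF that] by simp
      qed
      then have "\<forall>\<^sub>F x in E. g (to_nat (h \<xi> x)) = to_nat (h \<eta> x)"
        by (simp add: D_def eventually_filtermap k)
      then show False
        using undetermined[OF that] by blast
    qed
  qed
  with p_point_D show ?thesis
    by (intro exI[of _ D]) blast
qed

end
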